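(* Let $\mathcal{C}$ be a completely decomposable $[n,k]_{q^m/q}$ code of type $(n_1,\ldots,n_k)$ having as generator matrix $G=\mathbf{u}_1\oplus\ldots\oplus\mathbf{u}_k$ in a weight complementary form, and let $U_i$ be the $\mathbb{F}_q$-span of the entries of $\mathbf{u}_i$, for every $i$. Assume that $n_k=\ldots=n_{k-\ell}\neq n_{k-\ell-1}$ for some $\ell\in\{0,\ldots,k-1\}$, with $n_0:=0$. The number $A_{n_k}(\mathcal{C})$ of codewords of weight $n_k$ is $$A_{n_k}(\mathcal{C})=\sum_{t=k-\ell}^kA_{n_k}\left(\Sigma(\mathcal{C},t)\setminus\Sigma(\mathcal{C},t+1)\right)=\begin{cases}q^m-1&\text{if }\ell=0,\\(q^m-1)\left(\sum\limits_{i=k-\ell}^{k-1}\prod\limits_{h=i+1}^kq^{j_{i,h}}+1\right)&\text{otherwise,}\end{cases}$$ where $j_{i,h}=m-\dim_{\mathbb{F}_q}\left(U_i^{\perp^*}U_h\right)$, for every $i\in\{k-\ell,\ldots,k-1\}$ and $h\in\{i+1,\ldots,k\}$.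
   Context: Let $q$ be a prime power. The rank weight (here: weight) of $\mathbf{v}\in\mathbb{F}_{q^m}^n$ is the $\mathbb{F}_q$-dimension $\mathrm{w}(\mathbf{v})$ of the $\mathbb{F}_q$-span of its entries. For $S\subseteq\mathbb{F}_{q^m}^n$, $A_i(S)$ is the number of elements of $S$ of weight $i$. An $[n,k]_{q^m/q}$ code is a $k$-dimensional $\mathbb{F}_{q^m}$-subspace $\mathcal{C}$ of $\mathbb{F}_{q^m}^n$; a generator matrix is $G\in\mathbb{F}_{q^m}^{k\times n}$ with $\mathcal{C}=\{\mathbf{x}G:\mathbf{x}\in\mathbb{F}_{q^m}^k\}$. Two codes in $\mathbb{F}_{q^m}^n$ are equivalent if one is obtained from the other by right multiplication by some $A\in\mathrm{GL}(n,q)$. For integers $m>n_1\geq\ldots\geq n_k\geq1$, an $[n,k]_{q^m/q}$ code is completely decomposable of type $(n_1,\ldots,n_k)$ if $n=n_1+\ldots+n_k$ and it is equivalent to a code having a block-diagonal generator matrix $\mathbf{u}_1\oplus\ldots\oplus\mathbf{u}_k$ with $\mathbf{u}_i\in\mathbb{F}_{q^m}^{1\times n_i}$ and $\mathrm{w}(\mathbf{u}_i)=n_i$ for each $i$. A generator matrix of this block-diagonal form is said to be in a weight complementary form. If $\mathcal{C}$ has such a generator matrix, for $t\in\{1,\ldots,k\}$ the $t$-shortened code is $\Sigma(\mathcal{C},t)=\{(\alpha_1\mathbf{u}_1,\ldots,\alpha_k\mathbf{u}_k)\in\mathcal{C}:\alpha_i\in\mathbb{F}_{q^m},\ \alpha_i=0\text{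 for }i=1,\ldots,t-1\}\subseteq\mathbb{F}_{q^m}^n$; moreover $\Sigma(\mathcal{C},k+1):=\{\mathbf{0}\}$. For an $\mathbb{F}_q$-subspace $W\subseteq\mathbb{F}_{q^m}$, $W^{\perp^*}=\{b\in\mathbb{F}_{q^m}:\mathrm{Tr}_{q^m/q}(ab)=0\ \forall a\in W\}$, with $\mathrm{Tr}_{q^m/q}$ the trace from $\mathbb{F}_{q^m}$ to $\mathbb{F}_q$. For $\mathbb{F}_q$-subspaces $U,V\subseteq\mathbb{F}_{q^m}$, $UV$ denotes the $\mathbb{F}_q$-span of $\{ab:a\in U,b\in V\}$. *)

theory Defs
  imports "Jordan_Normal_Form.VS_Connect" "HOL-Library.Cardinality"
begin

text \<open>
  The extension of finite fields is given by two finite field types and a field homomorphism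
  \<open>emb\<close> from the small one (of size \<open>q\<close>) to the large one; through \<open>emb\<close> the large field is a vector
  space over the small one, with scalar multiplication \<open>fq_scale emb\<close>.
  The names \<open>span\<close> and \<open>dim\<close> below are those of HOL's linear algebra (theories Modules and
  Vector_Spaces), with scalars in the small field.
\<close>

definition fq_scale :: "('k::{field,finite} \<Rightarrow> 'a::{field,finite}) \<Rightarrow> 'k \<Rightarrow> 'a \<Rightarrow> 'a" where
  "fq_scale emb c x = emb c * x"

definition fq_span :: "('k::{field,finite} \<Rightarrow> 'a::{field,finite}) \<Rightarrow> 'a set \<Rightarrow> 'a set" where
  "fq_span emb S = Modules.module.span (fq_scale emb) S"

definition fq_dim :: "('k::{field,finite} \<Rightarrow> 'a::{field,finite}) \<Rightarrow> 'a set \<Rightarrow> nat" where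
  "fq_dim emb W = Vector_Spaces.vector_space.dim (fq_scale emb) W"

definition ext_degree :: "('k::{field,finite} \<Rightarrow> 'a::{field,finite}) \<Rightarrow> nat" where
  "ext_degree emb = fq_dim emb UNIV"

text \<open>The trace map; its values are elements of the large field lying in \<open>range emb\<close>.\<close>

definition fq_trace :: "('k::{field,finite} \<Rightarrow> 'a::{field,finite}) \<Rightarrow> 'a \<Rightarrow> 'a" where
  "fq_trace emb x = (\<Sum>i<ext_degree emb. x ^ (CARD('k) ^ i))"

definition trace_orth :: "('k::{field,finite} \<Rightarrow> 'a::{field,finite}) \<Rightarrow> 'a set \<Rightarrow> 'a set" where
  "trace_orth emb W = {b. \<forall>a\<in>W. fq_trace emb (a * b) = 0}"

definition fq_prod :: "('k::{field,finite} \<Rightarrow> 'a::{field,finite}) \<Rightarrow> 'a set \<Rightarrow> 'a set \<Rightarrow> 'a set" where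
  "fq_prod emb U V = fq_span emb {a * b | a b. a \<in> U \<and> b \<in> V}"

definition rank_weight :: "('k::{field,finite} \<Rightarrow> 'a::{field,finite}) \<Rightarrow> 'a vec \<Rightarrow> nat" where
  "rank_weight emb v = fq_dim emb (fq_span emb (vec_set v))"

definition weight_count ::
  "('k::{field,finite} \<Rightarrow> 'a::{field,finite}) \<Rightarrow> nat \<Rightarrow> 'a vec set \<Rightarrow> nat" where
  "weight_count emb i S = card {v \<in> S. rank_weight emb v = i}"

definition is_code :: "nat \<Rightarrow> nat \<Rightarrow> 'a::{field,finite} vec set \<Rightarrow> bool" where
  "is_code n k C \<longleftrightarrow>
     VectorSpace.subspace class_ring C (module_vec TYPE('a) n) \<and>
     vectorspace.dim class_ring (module_vec TYPE('a) n\<lparr>carrier := C\<rparr>) = k"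

text \<open>Codewords are row vectors, so \<open>v M\<close> is written \<open>transpose_mat M *\<^sub>v v\<close>.\<close>

definition generator_mat :: "nat \<Rightarrow> nat \<Rightarrow> 'a::{field,finite} vec set \<Rightarrow> 'a mat \<Rightarrow> bool" where
  "generator_mat n k C G \<longleftrightarrow>
     G \<in> carrier_mat k n \<and> C = {transpose_mat G *\<^sub>v x | x. x \<in> carrier_vec k}"

definition code_equiv ::
  "('k::{field,finite} \<Rightarrow> 'a::{field,finite}) \<Rightarrow> nat \<Rightarrow> 'a vec set \<Rightarrow> 'a vec set \<Rightarrow> bool" where
  "code_equiv emb n C D \<longleftrightarrow>
     (\<exists>A :: 'k mat. A \<in> carrier_mat n n \<and> invertible_mat A \<and>
        D = (\<lambda>v. transpose_mat (map_mat emb A) *\<^sub>v v) ` C)"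

text \<open>
  The sequences \<open>(n\<^sub>1, \<dots>, n\<^sub>k)\<close> and \<open>(u\<^sub>1, \<dots>, u\<^sub>k)\<close> are functions on \<open>nat\<close> of which only the
  arguments \<open>1, \<dots>, k\<close> are used; \<open>block_diag k u\<close> is the direct sum of \<open>u 1, \<dots>, u k\<close>, each taken as a
  matrix with a single row.
\<close>

definition block_diag :: "nat \<Rightarrow> (nat \<Rightarrow> 'a::{field,finite} vec) \<Rightarrow> 'a mat" where
  "block_diag k u = diag_block_mat (map (\<lambda>i. mat_of_rows (dim_vec (u i)) [u i]) [1..<Suc k])"

definition weight_complementary ::
  "('k::{field,finite} \<Rightarrow> 'a::{field,finite}) \<Rightarrow> nat \<Rightarrow> (nat \<Rightarrow> nat) \<Rightarrow> (nat \<Rightarrow> 'a vec) \<Rightarrow> 'a mat \<Rightarrow> bool"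
  where
  "weight_complementary emb k ns u G \<longleftrightarrow>
     (\<forall>i\<in>{1..k}. u i \<in> carrier_vec (ns i) \<and> rank_weight emb (u i) = ns i) \<and>
     G = block_diag k u"

definition completely_decomposable ::
  "('k::{field,finite} \<Rightarrow> 'a::{field,finite}) \<Rightarrow> nat \<Rightarrow> nat \<Rightarrow> (nat \<Rightarrow> nat) \<Rightarrow> 'a vec set \<Rightarrow> bool"
  where
  "completely_decomposable emb n k ns C \<longleftrightarrow>
     is_code n k C \<and>
     (\<forall>i\<in>{1..k}. 1 \<le> ns i \<and> ns i < ext_degree emb) \<and>
     (\<forall>i\<in>{1..k}. \<forall>j\<in>{1..k}. i \<le> j \<longrightarrow> ns j \<le> ns i) \<and>
     n = (\<Sum>i=1..k. ns i) \<and>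
     (\<exists>D u G. code_equiv emb n C D \<and> generator_mat n k D G \<and> weight_complementary emb k ns u G)"

definition block_word :: "nat \<Rightarrow> (nat \<Rightarrow> 'a::{field,finite} vec) \<Rightarrow> (nat \<Rightarrow> 'a) \<Rightarrow> 'a vec" where
  "block_word k u \<alpha> = foldr (\<lambda>i w. (\<alpha> i \<cdot>\<^sub>v u i) @\<^sub>v w) [1..<Suc k] vNil"

text \<open>
  The \<open>t\<close>-shortened code, relative to the blocks \<open>u\<close> of the chosen generator matrix; the clause for
  \<open>t = k + 1\<close> is the convention that it is then the zero code. Only \<open>1 \<le> t \<le> k + 1\<close> is meaningful.
\<close>

definition shortened ::
  "nat \<Rightarrow> nat \<Rightarrow> (nat \<Rightarrow> 'a::{field,finite} vec) \<Rightarrow> 'a vec set \<Rightarrow> nat \<Rightarrow> 'a vec set" where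
  "shortened n k u C t =
     (if t = k + 1 then {0\<^sub>v n}
      else {block_word k u \<alpha> | \<alpha>. block_word k u \<alpha> \<in> C \<and> (\<forall>i\<in>{1..<t}. \<alpha> i = 0)})"

end

theory Submission
  imports Defs
begin

text \<open>
  The weight of \<open>(\<alpha>\<^sub>1u\<^sub>1, \<dots>, \<alpha>\<^sub>ku\<^sub>k)\<close> is the dimension of \<open>\<alpha>\<^sub>1U\<^sub>1 + \<dots> + \<alpha>\<^sub>kU\<^sub>k\<close>. If \<open>\<alpha>\<^sub>t\<close> is the first
  nonzero coefficient, this sum contains \<open>\<alpha>\<^sub>tU\<^sub>t\<close>, so the weight is \<open>n\<^sub>k\<close> iff \<open>U\<^sub>t\<close> has dimension \<open>n\<^sub>k\<close> and
  \<open>\<alpha>\<^sub>hU\<^sub>h \<subseteq> \<alpha>\<^sub>tU\<^sub>t\<close> for all \<open>h > t\<close>. Since the trace form is nondegenerate, \<open>U\<^sub>t\<close> is its own double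
  orthogonal, and \<open>\<beta>U\<^sub>h \<subseteq> U\<^sub>t\<close> says precisely that \<open>\<beta>\<close> is orthogonal to \<open>U\<^sub>t\<^sup>\<bottom>U\<^sub>h\<close>. Hence \<open>\<alpha>\<^sub>t\<close> is any
  nonzero scalar and the quotients \<open>\<alpha>\<^sub>h / \<alpha>\<^sub>t\<close> range independently over these orthogonal spaces.
\<close>

section \<open>The trace form of an extension of finite fields\<close>

text \<open>Multiplication by a nonzero \<open>x\<close> permutes the nonzero elements; comparing
  their products before and after gives the exponent \<open>CARD('k) - 1\<close>.\<close>

lemma field_power_card: "x ^ CARD('k) = (x :: 'k::{field,finite})"
proof (cases "x = 0")
  case True
  then show ?thesis by (simp add: zero_power)
next
  case False
  have "(\<Prod>y\<in>UNIV - {0}. x * y) = (\<Prod>y\<in>UNIV - {0}. y)"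
    by (rule prod.reindex_bij_witness[of _ "\<lambda>y. y / x" "\<lambda>y. x * y"]) (use False in auto)
  then have "x ^ (CARD('k) - 1) * (\<Prod>y\<in>UNIV - {0}. y) = (\<Prod>y\<in>UNIV - {0::'k}. y)"
    by (simp add: prod.distrib)
  then have "x ^ (CARD('k) - 1) = 1"
    by simp
  then have "x * x ^ (CARD('k) - 1) = x"
    by simp
  then show ?thesis
    by (metis power_minus_mult zero_less_card_finite mult.commute)
qed

lemma two_le_card_field: "2 \<le> CARD('k::{field,finite})"
proof -
  have "card {0, 1 :: 'k} \<le> CARD('k)"
    by (rule card_mono) auto
  then show ?thesis by simp
qed

section \<open>The extension as a vector space, and its Frobenius map\<close>

locale finite_field_ext = field_hom emb for emb :: "'k::{field,finite} \<Rightarrow> 'a::{field,finite}"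
begin

sublocale fq: vector_space "fq_scale emb"
  by unfold_locales (simp_all add: fq_scale_def algebra_simps hom_distribs)


text \<open>Both sides are monic of degree q and vanish on the q elements of
  \<open>range emb\<close>, so their difference has too small a degree for its number of
  roots.\<close>

lemma prod_linear_factors: "(\<Prod>c\<in>UNIV. [:- emb c, 1:]) = monom 1 CARD('k) - [:0, 1:]"
proof (rule poly_eqI_degree_lead_coeff[where n = "CARD('k)" and A = "range emb"])
  have *: "degree (\<Prod>c\<in>UNIV. [:- emb c, 1:]) = CARD('k)"
    by (subst degree_prod_eq_sum_degree) auto
  then show "degree (\<Prod>c\<in>UNIV. [:- emb c, 1:]) \<le> CARD('k)" by simp
  have "lead_coeff (\<Prod>c\<in>UNIV. [:- emb c, 1:]) = 1"
    by (subst lead_coeff_prod) simp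
  \<comment> \<open>As q is at least 2, the linear term does not reach the coefficient compared
    here.\<close>
  then show "coeff (\<Prod>c\<in>UNIV. [:- emb c, 1:]) CARD('k) = coeff (monom 1 CARD('k) - [:0, 1:]) CARD('k)"
    using two_le_card_field[where ?'k = 'k] unfolding * by (auto simp: coeff_pCons split: nat.split)
  show "CARD('k) \<le> card (range emb)"
    by (simp add: card_image inj_f)
  show "degree (monom 1 CARD('k) - [:0, 1 :: 'a:]) \<le> CARD('k)"
    using two_le_card_field[where ?'k = 'k] by (intro degree_diff_le degree_monom_le) auto
  show "poly (\<Prod>c\<in>UNIV. [:- emb c, 1:]) z = poly (monom 1 CARD('k) - [:0, 1:]) z"
    if "z \<in> range emb" for z
    using that by (auto simp: poly_prod poly_monom prod_zero_iff simp flip: hom_power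
      simp: field_power_card)
qed

lemma power_card_minus_self: "x ^ CARD('k) - x = (\<Prod>c\<in>UNIV. x - emb c)"
  using arg_cong[OF prod_linear_factors, of "\<lambda>p. poly p x"]
  by (simp add: poly_prod poly_monom)

text \<open>This criterion for lying in the small field will show that traces have their values
  there.\<close>

lemma power_card_eq_self_iff: "x ^ CARD('k) = x \<longleftrightarrow> x \<in> range emb"
  using power_card_minus_self[of x]
  by (auto simp: prod_zero_iff simp flip: right_minus_eq[of "x ^ CARD('k)"])

text \<open>Shifting \<open>x\<close> by an element of the small field only permutes the factors in
  \<open>power_card_minus_self\<close>.\<close>

lemma frobenius_add_emb: "(x + emb c) ^ CARD('k) = x ^ CARD('k) + emb c"
proof -
  have "(\<Prod>d\<in>UNIV. x + emb c - emb d) = (\<Prod>d\<in>UNIV. x - emb d)"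
    by (rule prod.reindex_bij_witness[of _ "\<lambda>d. d + c" "\<lambda>d. d - c"])
       (auto simp: hom_distribs)
  then have "(x + emb c) ^ CARD('k) - (x + emb c) = x ^ CARD('k) - x"
    by (simp add: power_card_minus_self)
  then show ?thesis by (simp add: algebra_simps)
qed

text \<open>With \<open>q\<close> the size of the small field, the polynomial \<open>(x + Y)\<^sup>q - Y\<^sup>q\<close> in \<open>Y\<close> has degree
  less than \<open>q\<close> and takes the value \<open>x\<^sup>q\<close> at all \<open>q\<close> elements of the small field, so it is
  constant.\<close>

lemma frobenius_add: "(x + y) ^ CARD('k) = x ^ CARD('k) + (y :: 'a) ^ CARD('k)"
proof -
  have "[:x, 1:] ^ CARD('k) = monom 1 CARD('k) + [:x ^ CARD('k):]"
  proof (rule poly_eqI_degree_lead_coeff[where n = "CARD('k)" and A = "range emb"])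
    have *: "degree ([:x, 1:] ^ CARD('k)) = CARD('k)"
      by (simp add: degree_power_eq)
    then show "degree ([:x, 1:] ^ CARD('k)) \<le> CARD('k)" by simp
    have "lead_coeff ([:x, 1:] ^ CARD('k)) = 1"
      by (subst lead_coeff_power) simp
    then show "coeff ([:x, 1:] ^ CARD('k)) CARD('k) = coeff (monom 1 CARD('k) + [:x ^ CARD('k):]) CARD('k)"
      using two_le_card_field[where ?'k = 'k] unfolding * by (auto simp: coeff_pCons split: nat.split)
    show "CARD('k) \<le> card (range emb)"
      by (simp add: card_image inj_f)
    show "degree (monom 1 CARD('k) + [:x ^ CARD('k):]) \<le> CARD('k)"
      by (intro degree_add_le degree_monom_le) auto
    show "poly ([:x, 1:] ^ CARD('k)) z = poly (monom 1 CARD('k) + [:x ^ CARD('k):]) z" if "z \<in> range emb" for z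
      using that by (auto simp: poly_monom poly_power frobenius_add_emb field_power_card
        simp flip: hom_power)
  qed
  from arg_cong[OF this, of "\<lambda>p. poly p y"] show ?thesis
    by (simp add: poly_monom poly_power add.commute)
qed

lemma frobenius_iter_add: "(x + y) ^ (CARD('k) ^ i) = x ^ (CARD('k) ^ i) + (y :: 'a) ^ (CARD('k) ^ i)"
  by (induction i) (simp_all add: power_mult mult.commute[of "CARD('k)"] frobenius_add)

lemma emb_power_card_iter: "emb c ^ (CARD('k) ^ i) = emb c"
  by (induction i) (simp_all add: power_mult field_power_card flip: hom_power)

lemma trace_add: "fq_trace emb (x + y) = fq_trace emb x + fq_trace emb y"
  by (simp add: fq_trace_def frobenius_iter_add sum.distrib)

lemma trace_scale: "fq_trace emb (fq_scale emb c x) = fq_scale emb c (fq_trace emb x)"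
  by (simp add: fq_trace_def fq_scale_def power_mult_distrib emb_power_card_iter sum_distrib_left)

lemma trace_0 [simp]: "fq_trace emb 0 = 0"
  by (simp add: fq_trace_def)

section \<open>Bases and cardinalities of subspaces\<close>

lemma exists_basis:
  assumes "fq.subspace W"
  obtains B where "B \<subseteq> W" "\<not> fq.dependent B" "fq.span B = W" "card B = fq_dim emb W"
proof -
  obtain B where B: "B \<subseteq> W" "fq.independent B" "W \<subseteq> fq.span B" "card B = fq.dim W"
    using fq.basis_exists by blast
  moreover have "fq.span B = W"
    using B(1,3) assms fq.span_minimal by blast
  ultimately show ?thesis
    using that by (simp add: fq_dim_def)
qed

text \<open>Coordinates are taken as extensional functions on \<open>B\<close>, so that each element
  of the span has exactly one family of them. Most dimension arguments below are made by counting
  through this lemma.\<close>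

lemma card_span_independent:
  assumes "\<not> fq.dependent B"
  shows "card (fq.span B) = CARD('k) ^ card B"
proof -
  have "bij_betw (\<lambda>f. \<Sum>b\<in>B. fq_scale emb (f b) b) (B \<rightarrow>\<^sub>E UNIV) (fq.span B)"
  proof (rule bij_betw_imageI)
    show "inj_on (\<lambda>f. \<Sum>b\<in>B. fq_scale emb (f b) b) (B \<rightarrow>\<^sub>E UNIV)"
    proof (rule inj_onI)
      fix f g assume f: "f \<in> B \<rightarrow>\<^sub>E UNIV" "g \<in> B \<rightarrow>\<^sub>E UNIV"
        and "(\<Sum>b\<in>B. fq_scale emb (f b) b) = (\<Sum>b\<in>B. fq_scale emb (g b) b)"
      then have "(\<Sum>b\<in>B. fq_scale emb (f b - g b) b) = 0"
        by (simp add: fq.scale_left_diff_distrib sum_subtractf)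
      then have "f b - g b = 0" if "b \<in> B" for b
        by (rule fq.independentD[OF assms finite subset_refl _ that, where u = "\<lambda>b. f b - g b"])
      then show "f = g"
        using f by (intro PiE_ext) auto
    qed
    show "(\<lambda>f. \<Sum>b\<in>B. fq_scale emb (f b) b) ` (B \<rightarrow>\<^sub>E UNIV) = fq.span B"
    proof -
      have "(\<Sum>b\<in>B. fq_scale emb (f b) b) \<in>
        (\<lambda>f. \<Sum>b\<in>B. fq_scale emb (f b) b) ` (B \<rightarrow>\<^sub>E UNIV)" for f
        by (rule image_eqI[where x = "restrict f B"]) auto
      then show ?thesis
        using fq.span_finite[of B] by auto
    qed
  qed
  then have "card (B \<rightarrow>\<^sub>E (UNIV :: 'k set)) = card (fq.span B)"
    by (rule bij_betw_same_card)
  then show ?thesis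
    by (simp add: card_PiE)
qed

lemma card_subspace: "fq.subspace W \<Longrightarrow> card W = CARD('k) ^ fq_dim emb W"
  by (metis exists_basis card_span_independent)

lemma card_UNIV_eq: "CARD('a) = CARD('k) ^ ext_degree emb"
  by (simp add: card_subspace ext_degree_def fq.subspace_UNIV)

lemma ext_degree_pos: "0 < ext_degree emb"
  using card_UNIV_eq two_le_card_field[where ?'k = 'a] by (cases "ext_degree emb") auto

section \<open>Nondegeneracy of the trace form\<close>

lemma trace_in_range: "fq_trace emb x \<in> range emb"
proof -
  let ?m = "ext_degree emb"
  have frob_sum: "(\<Sum>i\<in>A. f i) ^ CARD('k) = (\<Sum>i\<in>A. f i ^ CARD('k))" if "finite A" for A and f :: "nat \<Rightarrow> 'a"
    using that by (induction A rule: finite_induct) (simp_all add: frobenius_add zero_power)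
  \<comment> \<open>The q-th power shifts every exponent by one step: the term \<open>x\<close> is
    lost and its power with exponent \<open>CARD('a)\<close> is gained, and these two agree.\<close>
  have "fq_trace emb x ^ CARD('k) = (\<Sum>i<?m. x ^ (CARD('k) ^ Suc i))"
    by (simp add: fq_trace_def frob_sum mult.commute flip: power_mult)
  also have "\<dots> = (\<Sum>i<Suc ?m. x ^ (CARD('k) ^ i)) - x"
    by (subst sum.lessThan_Suc_shift) simp
  also have "\<dots> = fq_trace emb x"
    using field_power_card[of x] by (simp add: fq_trace_def card_UNIV_eq)
  finally show ?thesis
    by (simp add: power_card_eq_self_iff)
qed

text \<open>The trace is a polynomial function of degree at most q^(m-1), which cannot vanish at all
  q^m points unless the polynomial is zero.\<close>

lemma trace_nonzero: "\<exists>x. fq_trace emb x \<noteq> 0"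
proof (rule ccontr)
  assume "\<not> ?thesis"
  then have zero: "\<And>x. fq_trace emb x = 0" by auto
  obtain d where d: "ext_degree emb = Suc d"
    using ext_degree_pos gr0_implies_Suc by blast
  let ?p = "\<Sum>i<Suc d. monom (1 :: 'a) (CARD('k) ^ i)"
  have "CARD('k) ^ d < CARD('a)"
    using two_le_card_field[where ?'k = 'k] by (simp add: card_UNIV_eq d)
  moreover have "degree ?p \<le> CARD('k) ^ d"
  proof (rule degree_sum_le)
    fix i assume "i \<in> {..<Suc d}"
    then show "degree (monom (1 :: 'a) (CARD('k) ^ i)) \<le> CARD('k) ^ d"
      by (auto intro!: power_increasing simp: degree_monom_eq less_Suc_eq_le)
  qed simp
  moreover have "poly ?p x = 0" for x
    using zero[of x] by (simp only: poly_sum poly_monom fq_trace_def d) simp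
  ultimately have "?p = 0"
    by (intro poly_eqI_degree[where A = UNIV]) auto
  \<comment> \<open>The exponents are pairwise distinct, so only the summand \<open>i = d\<close>
    contributes here.\<close>
  moreover have "coeff ?p (CARD('k) ^ d) = (\<Sum>i<Suc d. if i = d then 1 else 0)"
    unfolding coeff_sum
    using two_le_card_field[where ?'k = 'k] by (intro sum.cong) auto
  ultimately show False by simp
qed

lemma trace_nondegenerate:
  assumes "\<And>a. fq_trace emb (a * b) = 0"
  shows "b = 0"
proof (rule ccontr)
  assume "b \<noteq> 0"
  then have "fq_trace emb x = 0" for x
    using assms[of "x / b"] by simp
  then show False using trace_nonzero by blast
qed

section \<open>Orthogonals under the trace form\<close>

lemma subspace_trace_orth: "fq.subspace (trace_orth emb W)"
proof (rule fq.subspaceI)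
  fix c x assume "x \<in> trace_orth emb W"
  moreover have "a * fq_scale emb c x = fq_scale emb c (a * x)" for a
    by (simp add: fq_scale_def)
  ultimately show "fq_scale emb c x \<in> trace_orth emb W"
    by (simp add: trace_orth_def trace_scale)
qed (auto simp: trace_orth_def distrib_left trace_add)

lemma trace_orth_span: "trace_orth emb (fq.span B) = trace_orth emb B"
proof
  show "trace_orth emb (fq.span B) \<subseteq> trace_orth emb B"
    using fq.span_superset by (auto simp: trace_orth_def)
  show "trace_orth emb B \<subseteq> trace_orth emb (fq.span B)"
  proof
    fix y assume y: "y \<in> trace_orth emb B"
    \<comment> \<open>By commutativity this set is the orthogonal of \<open>{y}\<close>.\<close>
    have sub: "fq.subspace {a. fq_trace emb (a * y) = 0}"
      using subspace_trace_orth[of "{y}"] by (simp add: trace_orth_def mult.commute)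
    have "fq.span B \<subseteq> {a. fq_trace emb (a * y) = 0}"
      by (rule fq.span_minimal[OF _ sub]) (use y in \<open>auto simp: trace_orth_def\<close>)
    then show "y \<in> trace_orth emb (fq.span B)"
      by (auto simp: trace_orth_def)
  qed
qed

text \<open>The nonempty fibres of \<open>y \<mapsto> (Tr (b y))\<^sub>b\<close>, with \<open>b\<close> ranging over \<open>B\<close>, are cosets of the
  orthogonal of \<open>A \<union> B\<close>.\<close>

lemma card_trace_orth_step:
  "card (trace_orth emb A) \<le> CARD('k) ^ card B * card (trace_orth emb (A \<union> B))"
proof -
  define \<phi> where "\<phi> y = (\<lambda>b\<in>B. fq_trace emb (b * y))" for y
  let ?V = "trace_orth emb A"
  \<comment> \<open>Trace values lie in a set of q elements, which bounds the number of
    fibres.\<close>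
  have img: "\<phi> ` ?V \<subseteq> B \<rightarrow>\<^sub>E range emb"
    unfolding \<phi>_def using trace_in_range by auto
  have "card ?V = (\<Sum>z\<in>\<phi> ` ?V. card {y \<in> ?V. \<phi> y = z})"
    using sum.image_gen[of ?V "\<lambda>_. 1 :: nat" \<phi>] by simp
  also have "\<dots> \<le> (\<Sum>z\<in>\<phi> ` ?V. card (trace_orth emb (A \<union> B)))"
  proof (rule sum_mono)
    fix z assume "z \<in> \<phi> ` ?V"
    then obtain y0 where y0: "y0 \<in> ?V" "z = \<phi> y0" by blast
    have "y - y0 \<in> trace_orth emb (A \<union> B)" if y: "y \<in> ?V" "\<phi> y = z" for y
    proof -
      have "y - y0 \<in> ?V"
        using y y0 fq.subspace_diff[OF subspace_trace_orth] by blast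
      moreover have "fq_trace emb (b * (y - y0)) = 0" if "b \<in> B" for b
      proof -
        have "fq_trace emb (b * y) = fq_trace emb (b * y0)"
          using y(2) y0(2) that unfolding \<phi>_def by (metis restrict_apply')
        moreover have "fq_trace emb (b * y) = fq_trace emb (b * (y - y0)) + fq_trace emb (b * y0)"
          by (simp flip: trace_add distrib_left)
        ultimately show ?thesis by simp
      qed
      ultimately show ?thesis by (auto simp: trace_orth_def)
    qed
    then show "card {y \<in> ?V. \<phi> y = z} \<le> card (trace_orth emb (A \<union> B))"
      by (intro card_inj_on_le[where f = "\<lambda>y. y - y0"]) (auto simp: inj_on_def)
  qed
  also have "\<dots> = card (\<phi> ` ?V) * card (trace_orth emb (A \<union> B))"
    by simp
  also have "card (\<phi> ` ?V) \<le> card (B \<rightarrow>\<^sub>E range emb)"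
    by (rule card_mono[OF _ img]) (auto intro: finite_PiE)
  also have "\<dots> = CARD('k) ^ card B"
    by (simp add: card_PiE card_image inj_f)
  finally show ?thesis by simp
qed

lemma fq_dim_le: "fq_dim emb W \<le> ext_degree emb"
proof -
  obtain B where B: "fq.independent B" "card B = fq_dim emb W"
    using fq.basis_exists[of W] unfolding fq_dim_def by metis
  have "CARD('k) ^ card B \<le> CARD('k) ^ ext_degree emb"
    by (subst card_span_independent[OF B(1), symmetric], subst card_UNIV_eq[symmetric])
       (rule card_mono, auto)
  then show ?thesis
    using B two_le_card_field[where ?'k = 'k] by (simp add: power_increasing_iff)
qed

text \<open>Two uses of \<open>card_trace_orth_step\<close>. Extending a basis of \<open>W\<close>
  to the whole field cuts the orthogonal down to 0 by nondegeneracy, which bounds it above; imposing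
  the conditions of the basis on the whole field bounds it below.\<close>

lemma card_trace_orth:
  assumes "fq.subspace W"
  shows "card (trace_orth emb W) = CARD('k) ^ (ext_degree emb - fq_dim emb W)"
proof -
  let ?m = "ext_degree emb" and ?d = "fq_dim emb W"
  obtain B where B: "fq.independent B" "fq.span B = W" "card B = ?d"
    using exists_basis[OF assms] by metis
  define B' where "B' = fq.extend_basis B"
  have B': "B \<subseteq> B'" "fq.independent B'" "fq.span B' = UNIV"
    using B(1) by (simp_all add: B'_def fq.extend_basis_superset fq.independent_extend_basis)
  have "card B' = ?m"
    using fq.dim_eq_card[of B' UNIV] B' by (simp add: ext_degree_def fq_dim_def)
  then have diff: "card (B' - B) = ?m - ?d"
    using B B' by (simp add: card_Diff_subset)
  have "trace_orth emb B' = {0}"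
    using trace_nondegenerate trace_orth_span[of B'] B'(3) by (auto simp: trace_orth_def)
  then have "card (trace_orth emb B) \<le> CARD('k) ^ (?m - ?d)"
    using card_trace_orth_step[of B "B' - B"] B'(1) by (simp add: diff Un_absorb1)
  moreover have "CARD('k) ^ (?m - ?d) \<le> card (trace_orth emb B)"
  proof -
    have "CARD('k) ^ ?m \<le> CARD('k) ^ ?d * card (trace_orth emb B)"
      using card_trace_orth_step[of "{}" B] by (simp add: B(3) trace_orth_def card_UNIV_eq)
    moreover have "CARD('k) ^ ?m = CARD('k) ^ ?d * CARD('k) ^ (?m - ?d)"
      using fq_dim_le[of W] by (simp flip: power_add)
    ultimately show ?thesis by simp
  qed
  ultimately show ?thesis
    using trace_orth_span[of B] B(2) by simp
qed

text \<open>One inclusion is formal, and counting makes it an equality: taking the complementary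
  dimension twice returns the original one, where \<open>fq_dim_le\<close> keeps the truncated
  subtraction exact.\<close>

lemma trace_orth_trace_orth:
  assumes "fq.subspace W"
  shows "trace_orth emb (trace_orth emb W) = W"
proof -
  let ?d = "fq_dim emb W" and ?m = "ext_degree emb"
  have "CARD('k) ^ fq_dim emb (trace_orth emb W) = CARD('k) ^ (?m - ?d)"
    using card_subspace[OF subspace_trace_orth] card_trace_orth[OF assms] by simp
  then have "fq_dim emb (trace_orth emb W) = ?m - ?d"
    using two_le_card_field[where ?'k = 'k] by (simp add: power_inject_exp)
  then have "card (trace_orth emb (trace_orth emb W)) = card W"
    using fq_dim_le[of W] card_trace_orth[OF subspace_trace_orth, of W] card_subspace[OF assms]
    by simp
  moreover have "W \<subseteq> trace_orth emb (trace_orth emb W)"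
    by (auto simp: trace_orth_def mult.commute)
  ultimately show ?thesis
    by (metis card_subset_eq finite)
qed

text \<open>Writing \<open>W\<close> as a double orthogonal turns membership of
  \<open>\<beta> * v\<close> into trace conditions on \<open>\<beta>\<close> against the products
  \<open>a * v\<close>. This is the source of the exponents in the final formula.\<close>

lemma card_multipliers:
  assumes "fq.subspace W"
  shows "card {\<beta>. \<forall>v\<in>V. \<beta> * v \<in> W} =
    CARD('k) ^ (ext_degree emb - fq_dim emb (fq_prod emb (trace_orth emb W) V))"
proof -
  have assoc: "a * (\<beta> * v) = a * v * \<beta>" for a \<beta> v :: 'a
    by (simp add: mult_ac)
  have "{\<beta>. \<forall>v\<in>V. \<beta> * v \<in> W} = {\<beta>. \<forall>v\<in>V. \<beta> * v \<in> trace_orth emb (trace_orth emb W)}"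
    by (simp add: trace_orth_trace_orth assms)
  also have "\<dots> = trace_orth emb {a * b | a b. a \<in> trace_orth emb W \<and> b \<in> V}"
    unfolding trace_orth_def[of _ "trace_orth emb W"]
      trace_orth_def[of _ "{a * b | a b. a \<in> trace_orth emb W \<and> b \<in> V}"]
    by (auto simp: assoc)
  also have "\<dots> = trace_orth emb (fq_prod emb (trace_orth emb W) V)"
    by (simp add: fq_prod_def fq_span_def trace_orth_span)
  finally show ?thesis
    by (simp add: card_trace_orth fq_prod_def fq_span_def fq.subspace_span)
qed

end

section \<open>Words of a block-diagonal code\<close>


text \<open>An arbitrary index list allows induction, which the fixed list in
  \<open>block_word\<close> does not.\<close>

definition blocks_word :: "nat list \<Rightarrow> (nat \<Rightarrow> 'a::field vec) \<Rightarrow> (nat \<Rightarrow> 'a) \<Rightarrow> 'a vec" where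
  "blocks_word xs u \<alpha> = foldr (\<lambda>i w. (\<alpha> i \<cdot>\<^sub>v u i) @\<^sub>v w) xs vNil"

lemma block_word_eq: "block_word k u \<alpha> = blocks_word [1..<Suc k] u \<alpha>"
  by (simp add: block_word_def blocks_word_def)

lemma blocks_word_Nil [simp]: "blocks_word [] u \<alpha> = vNil"
  and blocks_word_Cons [simp]: "blocks_word (i # xs) u \<alpha> = (\<alpha> i \<cdot>\<^sub>v u i) @\<^sub>v blocks_word xs u \<alpha>"
  by (simp_all add: blocks_word_def)

lemma transpose_diag_mult_vec:
  fixes A B :: "'a::comm_ring_1 mat"
  assumes A: "A \<in> carrier_mat r1 c1" and B: "B \<in> carrier_mat r2 c2"
    and a: "a \<in> carrier_vec r1" and b: "b \<in> carrier_vec r2"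
  shows "transpose_mat (four_block_mat A (0\<^sub>m r1 c2) (0\<^sub>m r2 c1) B) *\<^sub>v (a @\<^sub>v b) =
    (transpose_mat A *\<^sub>v a) @\<^sub>v (transpose_mat B *\<^sub>v b)"
proof -
  have A': "transpose_mat A \<in> carrier_mat c1 r1" and B': "transpose_mat B \<in> carrier_mat c2 r2"
    using A B by simp_all
  have "transpose_mat (four_block_mat A (0\<^sub>m r1 c2) (0\<^sub>m r2 c1) B) =
      four_block_mat (transpose_mat A) (0\<^sub>m c1 r2) (0\<^sub>m c2 r1) (transpose_mat B)"
    by (simp add: transpose_four_block_mat[OF A zero_carrier_mat zero_carrier_mat B] zero_transpose_mat)
  moreover have "0\<^sub>m c1 r2 *\<^sub>v b = 0\<^sub>v c1" "0\<^sub>m c2 r1 *\<^sub>v a = 0\<^sub>v c2"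
    using a b by (auto intro!: eq_vecI simp: scalar_prod_def)
  ultimately show ?thesis
    using four_block_mat_mult_vec[OF A' zero_carrier_mat zero_carrier_mat B' a b]
      mult_mat_vec_carrier[OF A' a] mult_mat_vec_carrier[OF B' b]
    by simp
qed

text \<open>Peeling off the first block leaves a four-block matrix with zero off-diagonal blocks, to
  which \<open>transpose_diag_mult_vec\<close> applies.\<close>

lemma transpose_diag_block_mat_mult_vec:
  "transpose_mat (diag_block_mat (map (\<lambda>i. mat_of_rows (dim_vec (u i)) [u i]) xs)) *\<^sub>v
     vec_of_list (map \<alpha> xs) = blocks_word xs u \<alpha>"
proof (induction xs)
  case Nil
  show ?case by auto
next
  case (Cons i xs)
  define A where "A = mat_of_rows (dim_vec (u i)) [u i]"
  define B where "B = diag_block_mat (map (\<lambda>i. mat_of_rows (dim_vec (u i)) [u i]) xs)"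
  define a where "a = vec_of_list [\<alpha> i]"
  define b where "b = vec_of_list (map \<alpha> xs)"
  have A: "A \<in> carrier_mat 1 (dim_vec (u i))" by (auto simp: A_def)
  have B: "B \<in> carrier_mat (length xs) (dim_col B)"
    by (intro carrier_matI) (simp_all add: B_def dim_diag_block_mat o_def sum_list_triv)
  have a: "a \<in> carrier_vec 1" and b: "b \<in> carrier_vec (length xs)"
    by (intro carrier_vecI; simp add: a_def b_def)+
  have "transpose_mat A *\<^sub>v a = \<alpha> i \<cdot>\<^sub>v u i"
    by (rule eq_vecI) (auto simp: A_def a_def scalar_prod_def col_def mat_of_rows_def)
  moreover have "transpose_mat B *\<^sub>v b = blocks_word xs u \<alpha>"
    unfolding B_def b_def by (rule Cons.IH)
  moreover have "vec_of_list (map \<alpha> (i # xs)) = a @\<^sub>v b"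
    by (simp add: a_def b_def)
  moreover have "diag_block_mat (map (\<lambda>i. mat_of_rows (dim_vec (u i)) [u i]) (i # xs)) =
      four_block_mat A (0\<^sub>m 1 (dim_col B)) (0\<^sub>m (length xs) (dim_vec (u i))) B"
    using carrier_matD[OF A] carrier_matD[OF B] by (simp add: Let_def flip: A_def B_def)
  ultimately show ?case
    using transpose_diag_mult_vec[OF A B a b] by (simp only: blocks_word_Cons)
qed

lemma generated_code:
  assumes "generator_mat n k C (block_diag k u)"
  shows "C = range (block_word k u)"
proof -
  have word: "transpose_mat (block_diag k u) *\<^sub>v vec_of_list (map \<alpha> [1..<Suc k]) = block_word k u \<alpha>"
    for \<alpha>
    unfolding block_diag_def block_word_eq by (rule transpose_diag_block_mat_mult_vec)
  have C: "C = {transpose_mat (block_diag k u) *\<^sub>v x | x. x \<in> carrier_vec k}"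
    using assms by (simp add: generator_mat_def)
  show ?thesis
  proof (intro equalityI subsetI)
    fix v assume "v \<in> C"
    then obtain x where x: "x \<in> carrier_vec k" "v = transpose_mat (block_diag k u) *\<^sub>v x"
      using C by blast
    \<comment> \<open>Blocks are numbered from 1 and vector entries from 0.\<close>
    have "vec_of_list (map (\<lambda>i. x $ (i - 1)) [1..<Suc k]) = x"
      using x(1) by (intro eq_vecI) (auto simp: vec_of_list_index simp del: upt_Suc vec_of_list_map)
    then show "v \<in> range (block_word k u)"
      using word x(2) by (metis rangeI)
  next
    fix v assume "v \<in> range (block_word k u)"
    then obtain \<alpha> where "v = block_word k u \<alpha>" by blast
    moreover have "vec_of_list (map \<alpha> [1..<Suc k]) \<in> carrier_vec k"
      by (rule carrier_vecI) (simp del: upt_Suc vec_of_list_map)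
    ultimately show "v \<in> C"
      using C word by (metis (mono_tags, lifting) mem_Collect_eq)
  qed
qed

section \<open>Entries of block words and uniqueness of their coefficients\<close>

lemma vec_set_append: "vec_set (v @\<^sub>v w) = vec_set v \<union> vec_set w"
proof
  show "vec_set (v @\<^sub>v w) \<subseteq> vec_set v \<union> vec_set w"
    by (auto simp: vec_set_def)
  have "w $ i \<in> vec_set (v @\<^sub>v w)" if "i < dim_vec w" for i
    unfolding vec_set_def using that by (intro image_eqI[of _ _ "dim_vec v + i"]) auto
  moreover have "v $ i \<in> vec_set (v @\<^sub>v w)" if "i < dim_vec v" for i
    unfolding vec_set_def using that by (intro image_eqI[of _ _ i]) auto
  ultimately show "vec_set v \<union> vec_set w \<subseteq> vec_set (v @\<^sub>v w)"
    by (auto simp: vec_set_def[of v] vec_set_def[of w])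
qed

lemma vec_set_smult: "vec_set (c \<cdot>\<^sub>v v) = (*) c ` vec_set v"
  by (force simp: vec_set_def)

lemma vec_set_blocks_word: "vec_set (blocks_word xs u \<alpha>) = (\<Union>i\<in>set xs. (*) (\<alpha> i) ` vec_set (u i))"
proof (induction xs)
  case Nil
  show ?case by (simp add: vec_set_def)
qed (simp add: vec_set_append vec_set_smult)

lemma vec_set_block_word: "vec_set (block_word k u \<alpha>) = (\<Union>i\<in>{1..k}. (*) (\<alpha> i) ` vec_set (u i))"
  unfolding block_word_eq vec_set_blocks_word by (simp add: atLeastLessThanSuc_atLeastAtMost del: upt_Suc)

lemma smult_vec_right_cancel:
  fixes v :: "'a::field vec"
  assumes "v \<noteq> 0\<^sub>v (dim_vec v)"
  shows "a \<cdot>\<^sub>v v = b \<cdot>\<^sub>v v \<longleftrightarrow> a = b"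
proof -
  obtain i where "i < dim_vec v" "v $ i \<noteq> 0"
    using assms by (metis eq_vecI index_zero_vec)
  then show ?thesis
    by (metis index_smult_vec(1) mult_right_cancel)
qed

text \<open>Heads of equal length can be compared separately, and a nonzero block can be cancelled.
  Counting words thereby becomes counting coefficients.\<close>

lemma blocks_word_eq_iff:
  assumes "\<forall>i\<in>set xs. u i \<noteq> 0\<^sub>v (dim_vec (u i))"
  shows "blocks_word xs u \<alpha> = blocks_word xs u \<beta> \<longleftrightarrow> (\<forall>i\<in>set xs. \<alpha> i = \<beta> i)"
  using assms
proof (induction xs)
  case (Cons i xs)
  have "\<alpha> i \<cdot>\<^sub>v u i \<in> carrier_vec (dim_vec (u i))" "\<beta> i \<cdot>\<^sub>v u i \<in> carrier_vec (dim_vec (u i))"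
    by auto
  from append_vec_eq[OF this] show ?case
    using Cons by (auto simp: smult_vec_right_cancel)
qed simp

lemma block_word_eq_iff:
  assumes "\<forall>i\<in>{1..k}. u i \<noteq> 0\<^sub>v (dim_vec (u i))"
  shows "block_word k u \<alpha> = block_word k u \<beta> \<longleftrightarrow> (\<forall>i\<in>{1..k}. \<alpha> i = \<beta> i)"
  unfolding block_word_eq
  using blocks_word_eq_iff[of "[1..<Suc k]" u \<alpha> \<beta>] assms
  by (simp add: atLeastLessThanSuc_atLeastAtMost del: upt_Suc)

section \<open>The zero word and the shortened codes\<close>

lemma block_word_0: "block_word k u (\<lambda>_. 0) = 0\<^sub>v (\<Sum>i=1..k. dim_vec (u i))"
proof -
  have "blocks_word xs u (\<lambda>_. 0) = 0\<^sub>v (\<Sum>i\<leftarrow>xs. dim_vec (u i))" for xs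
    by (induction xs) (auto intro!: eq_vecI)
  then show ?thesis
    by (simp add: block_word_eq interv_sum_list_conv_sum_set_nat atLeastLessThanSuc_atLeastAtMost
      del: upt_Suc)
qed

text \<open>Uniqueness of coefficients lets the existential in \<open>shortened\<close> be read off
  \<open>\<alpha>\<close> itself. The convention at \<open>k + 1\<close> fits the same pattern,
  since the zero word has all coefficients zero.\<close>

lemma block_word_in_shortened_iff:
  assumes "\<forall>i\<in>{1..k}. u i \<noteq> 0\<^sub>v (dim_vec (u i))"
    and "C = range (block_word k u)" "n = (\<Sum>i=1..k. dim_vec (u i))" "t \<in> {1..Suc k}"
  shows "block_word k u \<alpha> \<in> shortened n k u C t \<longleftrightarrow> (\<forall>i\<in>{1..<t}. \<alpha> i = 0)"
proof (cases "t = k + 1")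
  case True
  have "block_word k u \<alpha> \<in> shortened n k u C t \<longleftrightarrow> block_word k u \<alpha> = block_word k u (\<lambda>_. 0)"
    by (simp add: shortened_def True assms(3) block_word_0)
  then show ?thesis
    by (simp add: block_word_eq_iff[OF assms(1)] True atLeastLessThanSuc_atLeastAtMost)
next
  case False
  have "block_word k u \<alpha> \<in> shortened n k u C t \<longleftrightarrow>
      (\<exists>\<beta>. block_word k u \<alpha> = block_word k u \<beta> \<and> (\<forall>i\<in>{1..<t}. \<beta> i = 0))"
    using False by (auto simp: shortened_def assms(2))
  moreover have "{1..<t} \<subseteq> {1..k}"
    using assms(4) False by auto
  ultimately show ?thesis
    by (auto simp: block_word_eq_iff[OF assms(1)] subset_iff)
qed

text \<open>The two membership conditions differ only at index \<open>t\<close>, so the differences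
  sort words by the position of their first nonzero coefficient.\<close>

lemma shortened_Diff_shortened_Suc:
  assumes "\<forall>i\<in>{1..k}. u i \<noteq> 0\<^sub>v (dim_vec (u i))"
    and "C = range (block_word k u)" "n = (\<Sum>i=1..k. dim_vec (u i))" "t \<in> {1..k}"
  shows "shortened n k u C t - shortened n k u C (t + 1) =
    {block_word k u \<alpha> | \<alpha>. (\<forall>i\<in>{1..<t}. \<alpha> i = 0) \<and> \<alpha> t \<noteq> 0}" (is "?L = ?R")
proof -
  have "{1..<t + 1} = insert t {1..<t}"
    using assms(4) by auto
  then have iff: "block_word k u \<alpha> \<in> shortened n k u C t \<and> block_word k u \<alpha> \<notin> shortened n k u C (t + 1) \<longleftrightarrow>
      (\<forall>i\<in>{1..<t}. \<alpha> i = 0) \<and> \<alpha> t \<noteq> 0" for \<alpha>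
    using assms(4) block_word_in_shortened_iff[OF assms(1-3), of t \<alpha>]
      block_word_in_shortened_iff[OF assms(1-3), of "t + 1" \<alpha>] by auto
  have "shortened n k u C t \<subseteq> range (block_word k u)"
    using assms(4) by (auto simp: shortened_def)
  then have "?L = {block_word k u \<alpha> | \<alpha>. block_word k u \<alpha> \<in> shortened n k u C t \<and>
      block_word k u \<alpha> \<notin> shortened n k u C (t + 1)}"
    by auto
  also have "\<dots> = ?R"
    by (simp only: iff)
  finally show ?thesis .
qed

section \<open>Rank weights of block words\<close>

context finite_field_ext
begin

lemma rank_weight_zero_vec: "rank_weight emb (0\<^sub>v n) = 0"
proof -
  have "fq.span (vec_set (0\<^sub>v n :: 'a vec)) = {0}"
    using fq.span_mono[of "vec_set (0\<^sub>v n :: 'a vec)" "{0}"] fq.span_zero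
    by (fastforce simp: vec_set_def)
  then have "CARD('k) ^ rank_weight emb (0\<^sub>v n :: 'a vec) = 1"
    using card_subspace[of "{0}"] by (simp add: rank_weight_def fq_span_def)
  then show ?thesis
    using two_le_card_field[where ?'k = 'k] by simp
qed

lemma span_times_image: "fq.span ((*) c ` S) = (*) c ` fq.span S"
proof -
  interpret module_hom "fq_scale emb" "fq_scale emb" "(*) c"
    by unfold_locales (simp_all add: fq_scale_def algebra_simps)
  show ?thesis by (rule span_image)
qed

lemma card_rank_weight: "card (fq_span emb (vec_set v)) = CARD('k) ^ rank_weight emb v"
  by (simp add: rank_weight_def fq_span_def card_subspace)

lemma span_block_word:
  "fq_span emb (vec_set (block_word k u \<alpha>)) =
     fq.span (\<Union>i\<in>{1..k}. (*) (\<alpha> i) ` fq_span emb (vec_set (u i)))"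
  unfolding vec_set_block_word fq_span_def
proof (subst fq.span_eq, intro conjI UN_least)
  fix i assume "i \<in> {1..k}"
  then have "fq.span ((*) (\<alpha> i) ` vec_set (u i)) \<subseteq> fq.span (\<Union>i\<in>{1..k}. (*) (\<alpha> i) ` vec_set (u i))"
    by (intro fq.span_mono) auto
  then show "(*) (\<alpha> i) ` fq.span (vec_set (u i)) \<subseteq>
      fq.span (\<Union>i\<in>{1..k}. (*) (\<alpha> i) ` vec_set (u i))"
    by (simp add: span_times_image)
next
  fix i assume "i \<in> {1..k}"
  then have "(*) (\<alpha> i) ` vec_set (u i) \<subseteq> (\<Union>i\<in>{1..k}. (*) (\<alpha> i) ` fq.span (vec_set (u i)))"
    using fq.span_superset by fast
  then show "(*) (\<alpha> i) ` vec_set (u i) \<subseteq>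
      fq.span (\<Union>i\<in>{1..k}. (*) (\<alpha> i) ` fq.span (vec_set (u i)))"
    using fq.span_superset by blast
qed

text \<open>Scaling by a nonzero element preserves cardinality, and the scaled block space lies in
  the space of the word.\<close>

lemma rank_weight_block_le:
  assumes "i \<in> {1..k}" "\<alpha> i \<noteq> 0"
  shows "rank_weight emb (u i) \<le> rank_weight emb (block_word k u \<alpha>)"
proof -
  have "(*) (\<alpha> i) ` fq_span emb (vec_set (u i)) \<subseteq> fq_span emb (vec_set (block_word k u \<alpha>))"
    using fq.span_superset assms(1) unfolding span_block_word by fast
  then have "card ((*) (\<alpha> i) ` fq_span emb (vec_set (u i))) \<le>
      card (fq_span emb (vec_set (block_word k u \<alpha>)))"
    by (intro card_mono) auto
  then have "CARD('k) ^ rank_weight emb (u i) \<le> CARD('k) ^ rank_weight emb (block_word k u \<alpha>)"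
    using assms(2) by (simp add: card_image inj_on_def card_rank_weight)
  then show ?thesis
    using two_le_card_field[where ?'k = 'k] by (simp add: power_increasing_iff)
qed

lemma rank_weight_block_word_eq_iff:
  assumes t: "t \<in> {1..k}" "\<alpha> t \<noteq> 0" and zero: "\<forall>i\<in>{1..<t}. \<alpha> i = 0"
  shows "rank_weight emb (block_word k u \<alpha>) = rank_weight emb (u t) \<longleftrightarrow>
    (\<forall>h\<in>{t+1..k}. \<forall>v\<in>fq_span emb (vec_set (u h)). \<alpha> h / \<alpha> t * v \<in> fq_span emb (vec_set (u t)))"
proof -
  define U where "U i = fq_span emb (vec_set (u i))" for i
  define S where "S = (\<Union>i\<in>{1..k}. (*) (\<alpha> i) ` U i)"
  define V where "V = (*) (\<alpha> t) ` U t"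
  have V: "fq.subspace V"
    by (simp add: V_def U_def fq_span_def flip: span_times_image)
  have mem_V: "x \<in> V \<longleftrightarrow> x / \<alpha> t \<in> U t" for x
    using t(2) by (auto simp: V_def image_iff intro!: bexI[of _ "x / \<alpha> t"])
  have sub: "V \<subseteq> fq.span S"
    using fq.span_superset t(1) unfolding S_def V_def by fast
  have "CARD('k) ^ rank_weight emb (block_word k u \<alpha>) = card (fq.span S)"
    by (simp add: S_def U_def span_block_word flip: card_rank_weight)
  moreover have "CARD('k) ^ rank_weight emb (u t) = card V"
    using t(2) by (simp add: V_def U_def card_image inj_on_def flip: card_rank_weight)
  ultimately have "rank_weight emb (block_word k u \<alpha>) = rank_weight emb (u t) \<longleftrightarrow>
      card (fq.span S) = card V"
    using two_le_card_field[where ?'k = 'k] by (metis power_inject_exp Suc_1 Suc_le_lessD)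
  \<comment> \<open>\<open>V\<close> is contained in the span, so for finite sets equal size means
    equality.\<close>
  also have "\<dots> \<longleftrightarrow> fq.span S = V"
    using sub by (metis card_subset_eq finite)
  also have "\<dots> \<longleftrightarrow> S \<subseteq> V"
    using sub V fq.span_superset fq.span_minimal by blast
  also have "\<dots> \<longleftrightarrow> (\<forall>h\<in>{1..k}. \<forall>v\<in>U h. \<alpha> h / \<alpha> t * v \<in> U t)"
    unfolding S_def using mem_V by auto
  \<comment> \<open>Blocks before \<open>t\<close> have quotient 0 and block \<open>t\<close> has
    quotient 1, so both satisfy the condition.\<close>
  also have "\<dots> \<longleftrightarrow> (\<forall>h\<in>{t+1..k}. \<forall>v\<in>U h. \<alpha> h / \<alpha> t * v \<in> U t)"
  proof -
    have 0: "0 \<in> U t"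
      by (simp add: U_def fq_span_def fq.span_zero)
    have "\<alpha> h / \<alpha> t * v \<in> U t" if "h \<in> {1..k}" "h \<notin> {t+1..k}" "v \<in> U h" for h v
    proof (cases "h = t")
      case True
      then show ?thesis using that t by simp
    next
      case False
      then have "\<alpha> h = 0" using that zero by simp
      then show ?thesis using 0 by simp
    qed
    then show ?thesis using t by auto
  qed
  finally show ?thesis by (simp add: U_def)
qed

lemma card_words_first_block:
  assumes nz: "\<forall>i\<in>{1..k}. u i \<noteq> 0\<^sub>v (dim_vec (u i))" and t: "t \<in> {1..k}"
  shows "card {block_word k u \<alpha> | \<alpha>. (\<forall>i\<in>{1..<t}. \<alpha> i = 0) \<and> \<alpha> t \<noteq> 0 \<and>
      rank_weight emb (block_word k u \<alpha>) = rank_weight emb (u t)} =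
    (CARD('a) - 1) * (\<Prod>h=t+1..k. CARD('k) ^ (ext_degree emb -
      fq_dim emb (fq_prod emb (trace_orth emb (fq_span emb (vec_set (u t))))
        (fq_span emb (vec_set (u h))))))"
    (is "card ?W = _")
proof -
  define U where "U i = fq_span emb (vec_set (u i))" for i
  define M where "M h = {\<beta>. \<forall>v\<in>U h. \<beta> * v \<in> U t}" for h
  \<comment> \<open>A pair holds the coefficient at \<open>t\<close> and the later quotients by it;
    \<open>word\<close> rebuilds the coefficients. Extensionality of the quotient family makes the
    parametrization injective.\<close>
  define word where "word p i = (if i < t then 0 else if i = t then fst p else fst p * snd p i)"
    for p :: "'a \<times> (nat \<Rightarrow> 'a)" and i
  let ?D = "(UNIV - {0 :: 'a}) \<times> (\<Pi>\<^sub>E h\<in>{t+1..k}. M h)"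
  have W: "v \<in> ?W \<longleftrightarrow> (\<exists>\<alpha>. v = block_word k u \<alpha> \<and> (\<forall>i\<in>{1..<t}. \<alpha> i = 0) \<and> \<alpha> t \<noteq> 0 \<and>
      (\<forall>h\<in>{t+1..k}. \<alpha> h / \<alpha> t \<in> M h))" for v
    using rank_weight_block_word_eq_iff[OF t, of _ u] unfolding M_def U_def by blast
  have "bij_betw (\<lambda>p. block_word k u (word p)) ?D ?W"
  proof (rule bij_betw_imageI)
    show "inj_on (\<lambda>p. block_word k u (word p)) ?D"
    proof (rule inj_onI)
      fix p p' assume p: "p \<in> ?D" "p' \<in> ?D" and "block_word k u (word p) = block_word k u (word p')"
      then have eq: "\<forall>i\<in>{1..k}. word p i = word p' i"
        by (simp add: block_word_eq_iff[OF nz])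
      obtain \<gamma> \<beta> \<gamma>' \<beta>' where [simp]: "p = (\<gamma>, \<beta>)" "p' = (\<gamma>', \<beta>')"
        by (cases p, cases p')
      have \<gamma>: "\<gamma> = \<gamma>'" "\<gamma> \<noteq> 0"
        using eq t p by (auto simp: word_def dest: bspec[of _ _ t])
      have "\<beta> = \<beta>'"
      proof (rule PiE_ext)
        show "\<beta> \<in> (\<Pi>\<^sub>E h\<in>{t+1..k}. M h)" "\<beta>' \<in> (\<Pi>\<^sub>E h\<in>{t+1..k}. M h)"
          using p by auto
        fix h assume "h \<in> {t+1..k}"
        then show "\<beta> h = \<beta>' h"
          using bspec[OF eq, of h] \<gamma> t by (auto simp: word_def)
      qed
      with \<gamma> show "p = p'" by simp
    qed
    show "(\<lambda>p. block_word k u (word p)) ` ?D = ?W"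
    proof (intro equalityI subsetI)
      fix v assume "v \<in> (\<lambda>p. block_word k u (word p)) ` ?D"
      then obtain \<gamma> \<beta> where *: "\<gamma> \<noteq> 0" "\<beta> \<in> (\<Pi>\<^sub>E h\<in>{t+1..k}. M h)" "v = block_word k u (word (\<gamma>, \<beta>))"
        by auto
      then show "v \<in> ?W"
        unfolding W by (intro exI[of _ "word (\<gamma>, \<beta>)"]) (auto simp: word_def PiE_mem)
    next
      fix v assume "v \<in> ?W"
      then obtain \<alpha> where \<alpha>: "v = block_word k u \<alpha>" "\<forall>i\<in>{1..<t}. \<alpha> i = 0" "\<alpha> t \<noteq> 0"
        "\<forall>h\<in>{t+1..k}. \<alpha> h / \<alpha> t \<in> M h"
        unfolding W by blast
      let ?p = "(\<alpha> t, \<lambda>h\<in>{t+1..k}. \<alpha> h / \<alpha> t)"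
      have "word ?p i = \<alpha> i" if "i \<in> {1..k}" for i
        using \<alpha> that by (auto simp: word_def)
      then have "v = block_word k u (word ?p)"
        using \<alpha>(1) by (simp add: block_word_eq_iff[OF nz])
      moreover have "?p \<in> ?D"
        using \<alpha> by auto
      ultimately show "v \<in> (\<lambda>p. block_word k u (word p)) ` ?D"
        by blast
    qed
  qed
  then have "card ?W = card ?D"
    by (rule bij_betw_same_card[symmetric])
  also have "\<dots> = (CARD('a) - 1) * (\<Prod>h=t+1..k. card (M h))"
    by (simp add: card_cartesian_product card_PiE card_Diff_subset)
  also have "\<dots> = (CARD('a) - 1) * (\<Prod>h=t+1..k.
      CARD('k) ^ (ext_degree emb - fq_dim emb (fq_prod emb (trace_orth emb (U t)) (U h))))"
  proof -
    have "fq.subspace (U t)" by (simp add: U_def fq_span_def)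
    then show ?thesis by (simp only: M_def card_multipliers)
  qed
  finally show ?thesis by (simp add: U_def)
qed

end

section \<open>Assembling the count\<close>

theorem theorem4p5:
  fixes emb :: "'k::{field,finite} \<Rightarrow> 'a::{field,finite}"
    and q m n k l :: nat
    and ns :: "nat \<Rightarrow> nat"
    and C :: "'a vec set"
    and G :: "'a mat"
    and u :: "nat \<Rightarrow> 'a vec"
    and U :: "nat \<Rightarrow> 'a set"
    and j :: "nat \<Rightarrow> nat \<Rightarrow> nat"
  assumes "field_hom emb"
    and "q = CARD('k)"
    and "m = ext_degree emb"
    and "completely_decomposable emb n k ns C"
    and "generator_mat n k C G"
    and "weight_complementary emb k ns u G"
    and "\<And>i. i \<in> {1..k} \<Longrightarrow> U i = fq_span emb (vec_set (u i))"
    and "ns 0 = 0"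
    and "l < k"
    and "\<And>i. i \<in> {k - l..k} \<Longrightarrow> ns i = ns k"
    and "ns (k - l - 1) \<noteq> ns k"
    and "\<And>i h. i \<in> {k - l..k - 1} \<Longrightarrow> h \<in> {i + 1..k} \<Longrightarrow>
           j i h = m - fq_dim emb (fq_prod emb (trace_orth emb (U i)) (U h))"
  shows "weight_count emb (ns k) C =
           (\<Sum>t=k - l..k. weight_count emb (ns k) (shortened n k u C t - shortened n k u C (t + 1)))
       \<and> (\<Sum>t=k - l..k. weight_count emb (ns k) (shortened n k u C t - shortened n k u C (t + 1))) =
           (if l = 0 then q ^ m - 1
            else (q ^ m - 1) * ((\<Sum>i=k - l..k - 1. \<Prod>h=i + 1..k. q ^ j i h) + 1))"
proof -
  interpret field_hom emb by (rule assms(1))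
  interpret finite_field_ext emb by unfold_locales
  note U = assms(7) and eq = assms(10) and j = assms(12)
  have ns: "\<And>i. i \<in> {1..k} \<Longrightarrow> 1 \<le> ns i" "\<And>i h. i \<in> {1..k} \<Longrightarrow> h \<in> {1..k} \<Longrightarrow> i \<le> h \<Longrightarrow> ns h \<le> ns i"
      "n = (\<Sum>i=1..k. ns i)"
    using assms(4) by (auto simp: completely_decomposable_def)
  have dim: "dim_vec (u i) = ns i" and wt: "rank_weight emb (u i) = ns i" if "i \<in> {1..k}" for i
    using assms(6) that by (auto simp: weight_complementary_def)
  have nz: "\<forall>i\<in>{1..k}. u i \<noteq> 0\<^sub>v (dim_vec (u i))"
  proof
    fix i assume "i \<in> {1..k}"
    then show "u i \<noteq> 0\<^sub>v (dim_vec (u i))"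
      using rank_weight_zero_vec[of "dim_vec (u i)"] wt[of i] ns(1)[of i] by auto
  qed
  have n: "n = (\<Sum>i=1..k. dim_vec (u i))"
    using ns(3) dim by simp
  have C: "C = range (block_word k u)"
    using assms(5,6) by (intro generated_code[of n]) (simp add: weight_complementary_def)
  \<comment> \<open>Vectors of all lengths share one type, which is infinite; finiteness comes from
    the finitely many coefficients on \<open>{1..k}\<close>.\<close>
  have fin: "finite C"
  proof (rule finite_subset)
    have "block_word k u \<alpha> \<in> block_word k u ` ({1..k} \<rightarrow>\<^sub>E UNIV)" for \<alpha>
      by (rule image_eqI[where x = "restrict \<alpha> {1..k}"]) (simp_all add: block_word_eq_iff[OF nz])
    then show "C \<subseteq> block_word k u ` ({1..k} \<rightarrow>\<^sub>E UNIV)"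
      using C by auto
  qed (simp add: finite_PiE)
  \<comment> \<open>By monotonicity, \<open>ns (k - l - 1)\<close> differing from
    \<open>ns k\<close> must exceed it, and earlier sizes are no smaller. For
    \<open>k - l = 1\<close> the range is empty.\<close>
  have large: "ns k < ns i" if "i \<in> {1..<k - l}" for i
    using ns(2)[of i "k - l - 1"] ns(2)[of "k - l - 1" k] that assms(9,11) by force
  define A where "A t = {v \<in> shortened n k u C t - shortened n k u C (t + 1).
      rank_weight emb v = ns k}" for t
  have range: "{k - l..k} \<subseteq> {1..k}"
    using assms(9) by auto
  have A: "A t = {block_word k u \<alpha> | \<alpha>. (\<forall>i\<in>{1..<t}. \<alpha> i = 0) \<and> \<alpha> t \<noteq> 0 \<and>
      rank_weight emb (block_word k u \<alpha>) = ns k}" if "t \<in> {k - l..k}" for t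
    using that range unfolding A_def by (subst shortened_Diff_shortened_Suc[OF nz C n]) auto
  have "{v \<in> C. rank_weight emb v = ns k} = (\<Union>t\<in>{k - l..k}. A t)"
  proof (intro equalityI subsetI)
    fix v assume v: "v \<in> {v \<in> C. rank_weight emb v = ns k}"
    then obtain \<alpha> where \<alpha>: "v = block_word k u \<alpha>"
      using C by blast
    have "\<exists>i. i \<in> {1..k} \<and> \<alpha> i \<noteq> 0"
    proof (rule ccontr)
      assume "\<not> ?thesis"
      then have "v = 0\<^sub>v (\<Sum>i=1..k. dim_vec (u i))"
        unfolding \<alpha> block_word_0[symmetric] block_word_eq_iff[OF nz] by auto
      then show False
        using v rank_weight_zero_vec ns(1)[of k] assms(9) by auto
    qed
    then obtain t where t: "t \<in> {1..k}" "\<alpha> t \<noteq> 0" "\<forall>i<t. \<not> (i \<in> {1..k} \<and> \<alpha> i \<noteq> 0)"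
      by (subst (asm) exists_least_iff) blast
    \<comment> \<open>The block at the first nonzero coefficient cannot outweigh the word, so
      \<open>large\<close> excludes \<open>t < k - l\<close>.\<close>
    have "ns t \<le> ns k"
      using rank_weight_block_le[of t k \<alpha> u] t v \<alpha> wt by auto
    then have "t \<in> {k - l..k}"
      using large[of t] t(1) by force
    moreover have "v \<in> A t"
      using A[OF calculation] \<alpha> t v by auto
    ultimately show "v \<in> (\<Union>t\<in>{k - l..k}. A t)" by blast
  next
    fix v assume "v \<in> (\<Union>t\<in>{k - l..k}. A t)"
    then show "v \<in> {v \<in> C. rank_weight emb v = ns k}"
      using A C by auto
  qed
  \<comment> \<open>Words in \<open>A t\<close> have coefficient 0 at \<open>s\<close>, words in
    \<open>A s\<close> do not.\<close>
  moreover have disj: "A s \<inter> A t = {}" if "s \<in> {k - l..k}" "t \<in> {k - l..k}" "s < t" for s t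
  proof -
    have "s \<in> {1..<t}" "s \<in> {1..k}"
      using that range by auto
    then show ?thesis
      unfolding A[OF that(1)] A[OF that(2)] by (auto simp: block_word_eq_iff[OF nz])
  qed
  moreover have "card (\<Union>t\<in>{k - l..k}. A t) = (\<Sum>t=k - l..k. card (A t))"
  proof (rule card_UN_disjoint)
    have "A t \<subseteq> C" if "t \<in> {k - l..k}" for t
      using A[OF that] C by auto
    then show "\<forall>t\<in>{k - l..k}. finite (A t)"
      using fin finite_subset by blast
    show "\<forall>s\<in>{k - l..k}. \<forall>t\<in>{k - l..k}. s \<noteq> t \<longrightarrow> A s \<inter> A t = {}"
      using disj by (metis Int_commute neq_iff)
  qed simp
  ultimately have 1: "weight_count emb (ns k) C = (\<Sum>t=k - l..k. card (A t))"
    by (simp add: weight_count_def)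
  define P where "P t = (\<Prod>h=t+1..k. q ^ (m - fq_dim emb (fq_prod emb (trace_orth emb (U t)) (U h))))"
    for t
  have card_A: "card (A t) = (q ^ m - 1) * P t" if "t \<in> {k - l..k}" for t
  proof -
    have t: "t \<in> {1..k}" using that range by blast
    then have "(\<Prod>h=t+1..k. CARD('k) ^ (ext_degree emb -
      fq_dim emb (fq_prod emb (trace_orth emb (fq_span emb (vec_set (u t))))
        (fq_span emb (vec_set (u h)))))) = P t"
      unfolding P_def using U assms(2,3) by (intro prod.cong) auto
    \<comment> \<open>Here \<open>ns t = ns k\<close>, so the weight of block \<open>t\<close> is
      the weight being counted.\<close>
    then show ?thesis
      using card_words_first_block[OF nz t] A[OF that] eq[OF that] wt[OF t]
      by (simp add: card_UNIV_eq assms(2,3))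
  qed
  \<comment> \<open>No block follows \<open>k\<close>, so its product is empty; this is the separate
    summand 1.\<close>
  have "{k - l..k} = insert k {k - l..k - 1}"
    using assms(9) by auto
  then have "(\<Sum>t=k - l..k. P t) = P k + (\<Sum>t=k - l..k - 1. P t)"
    using assms(9) by simp
  also have "P k = 1" by (simp add: P_def)
  also have "(\<Sum>t=k - l..k - 1. P t) = (\<Sum>i=k - l..k - 1. \<Prod>h=i + 1..k. q ^ j i h)"
    unfolding P_def using j by (intro sum.cong prod.cong) auto
  finally have "(\<Sum>t=k - l..k. card (A t)) =
      (q ^ m - 1) * ((\<Sum>i=k - l..k - 1. \<Prod>h=i + 1..k. q ^ j i h) + 1)"
    by (simp add: card_A flip: sum_distrib_left)
  moreover have "weight_count emb (ns k) (shortened n k u C t - shortened n k u C (t + 1)) = card (A t)" for t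
    by (simp add: weight_count_def A_def)
  \<comment> \<open>For \<open>l = 0\<close> the range \<open>{k..k - 1}\<close> is empty because
    \<open>k\<close> is positive, so the first case is an instance of the general formula.\<close>
  ultimately show ?thesis
    using 1 assms(9) by auto
qed

end
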